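(* Every $\{\emptyset,\langle\cdot\rangle,\uplus\}$-structure satisfying the axioms $\mathrm{F}_1$–$\mathrm{F}_8$ admits an expansion (by an interpretation of $\sqsubseteq$) to a model of $\mathsf{F}^{-}$. Consequently, $\mathsf{F}^{-}$ is conservative over $\mathrm{F}_1$–$\mathrm{F}_8$ for $\sqsubseteq$-free sentences: if $\mathsf{F}^{-}\vdash\varphi$ and $\varphi$ does not contain $\sqsubseteq$, then $\mathrm{F}_1,\dots,\mathrm{F}_8\vdash\varphi$.
   Context: The theory $\mathsf{F}^{-}$ is a first-order theory with equality in the language $L=\{\emptyset,\langle\cdot\rangle,\uplus,\sqsubseteq\}$ (constant, unary function, binary function, binary relation), with axioms (all free variables universally quantified): $\mathrm{F}_1$: $(x\uplus y)\uplus z=x\uplus(y\uplus z)$; $\mathrm{F}_2$: $x\uplus y=y\uplus x$; $\mathrm{F}_3$: $x\uplus\emptyset=x$; $\mathrm{F}_4$: $x\uplus z=y\uplus z\rightarrow x=y$; $\mathrm{F}_5$: $\langle x\rangle\ne\emptyset$; $\mathrm{F}_6$: $x\uplus y=\emptyset\rightarrow x=\emptyset$; $\mathrm{F}_7$: $\langle x\rangle=\langle y\rangle\rightarrow x=y$; $\mathrm{F}_8$: $u\uplus v=\langle x\rangle\uplus w\rightarrow\exists w'\,(u=\langle x\rangle\uplus w'\vee v=\langle x\rangle\uplus w')$; $\mathrm{F}_9$: $x\sqsubseteq t\leftrightarrow\bigl(x=t\vee\exists w\,\exists u\,(t=w\uplus\langle u\rangle\wedge x\sqsubseteq u)\bigr)$.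 *)

theory Defs
  imports Main
begin

section \<open>Syntax\<close>

text \<open>Variables are de Bruijn indices: \<open>Var 0\<close> is bound by the innermost enclosing \<open>All\<close>.
  Every function symbol of the language is already present in the \<open>\<sqsubseteq>\<close>-free
  sublanguage, so both languages share the terms.\<close>

datatype tm =
    Var nat
  | Emp
  | Sing tm
  | Join tm tm

datatype fm =
    Falsity
  | Eq tm tm
  | Sub tm tm
  | Imp fm fm
  | All fm

abbreviation Neg :: "fm \<Rightarrow> fm" where "Neg \<phi> \<equiv> Imp \<phi> Falsity"
abbreviation Disj :: "fm \<Rightarrow> fm \<Rightarrow> fm" where "Disj \<phi> \<psi> \<equiv> Imp (Neg \<phi>) \<psi>"
abbreviation Conj :: "fm \<Rightarrow> fm \<Rightarrow> fm" where "Conj \<phi> \<psi> \<equiv> Neg (Imp \<phi> (Neg \<psi>))"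
abbreviation Iff :: "fm \<Rightarrow> fm \<Rightarrow> fm" where "Iff \<phi> \<psi> \<equiv> Conj (Imp \<phi> \<psi>) (Imp \<psi> \<phi>)"
abbreviation Ex :: "fm \<Rightarrow> fm" where "Ex \<phi> \<equiv> Neg (All (Neg \<phi>))"

primrec sub_free :: "fm \<Rightarrow> bool" where
  "sub_free Falsity = True"
| "sub_free (Eq s t) = True"
| "sub_free (Sub s t) = False"
| "sub_free (Imp \<phi> \<psi>) = (sub_free \<phi> \<and> sub_free \<psi>)"
| "sub_free (All \<phi>) = sub_free \<phi>"

primrec fv_tm :: "tm \<Rightarrow> nat set" where
  "fv_tm (Var n) = {n}"
| "fv_tm Emp = {}"
| "fv_tm (Sing t) = fv_tm t"
| "fv_tm (Join s t) = fv_tm s \<union> fv_tm t"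

primrec fv :: "fm \<Rightarrow> nat set" where
  "fv Falsity = {}"
| "fv (Eq s t) = fv_tm s \<union> fv_tm t"
| "fv (Sub s t) = fv_tm s \<union> fv_tm t"
| "fv (Imp \<phi> \<psi>) = fv \<phi> \<union> fv \<psi>"
| "fv (All \<phi>) = {n. Suc n \<in> fv \<phi>}"

definition sentence :: "fm \<Rightarrow> bool" where
  "sentence \<phi> \<longleftrightarrow> fv \<phi> = {}"

primrec subst_tm :: "(nat \<Rightarrow> tm) \<Rightarrow> tm \<Rightarrow> tm" where
  "subst_tm \<sigma> (Var n) = \<sigma> n"
| "subst_tm \<sigma> Emp = Emp"
| "subst_tm \<sigma> (Sing t) = Sing (subst_tm \<sigma> t)"
| "subst_tm \<sigma> (Join s t) = Join (subst_tm \<sigma> s) (subst_tm \<sigma> t)"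

definition under_binder :: "(nat \<Rightarrow> tm) \<Rightarrow> nat \<Rightarrow> tm" where
  "under_binder \<sigma> = case_nat (Var 0) (\<lambda>n. subst_tm (\<lambda>k. Var (Suc k)) (\<sigma> n))"

primrec subst :: "(nat \<Rightarrow> tm) \<Rightarrow> fm \<Rightarrow> fm" where
  "subst \<sigma> Falsity = Falsity"
| "subst \<sigma> (Eq s t) = Eq (subst_tm \<sigma> s) (subst_tm \<sigma> t)"
| "subst \<sigma> (Sub s t) = Sub (subst_tm \<sigma> s) (subst_tm \<sigma> t)"
| "subst \<sigma> (Imp \<phi> \<psi>) = Imp (subst \<sigma> \<phi>) (subst \<sigma> \<psi>)"
| "subst \<sigma> (All \<phi>) = All (subst (under_binder \<sigma>) \<phi>)"

definition lift :: "fm \<Rightarrow> fm" where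
  "lift = subst (\<lambda>n. Var (Suc n))"

text \<open>\<open>inst t \<phi>\<close> replaces variable 0 of \<open>\<phi>\<close> by \<open>t\<close> and lowers the other free
  variables by one, so that \<open>inst t \<phi>\<close> is the instance at \<open>t\<close> of \<open>All \<phi>\<close>.\<close>

definition inst :: "tm \<Rightarrow> fm \<Rightarrow> fm" where
  "inst t = subst (case_nat t Var)"


section \<open>Provability\<close>

text \<open>Classical natural deduction with equality. In \<open>\<Lambda>; \<Gamma> \<turnstile> \<phi>\<close> the set \<open>\<Lambda>\<close> is the set of
  formulas of the language in which the derivation is carried out, and \<open>\<Gamma>\<close> is the
  (possibly infinite) set of open assumptions. In \<open>AllI\<close> the eigenvariable is index 0,
  which does not occur in any lifted assumption.\<close>

inductive derives :: "fm set \<Rightarrow> fm set \<Rightarrow> fm \<Rightarrow> bool" ("_; _ \<turnstile> _" [51, 51, 51] 50)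
  for \<Lambda> :: "fm set" where
  Assm: "\<phi> \<in> \<Gamma> \<Longrightarrow> \<phi> \<in> \<Lambda> \<Longrightarrow> \<Lambda>; \<Gamma> \<turnstile> \<phi>"
| ImpI: "\<phi> \<in> \<Lambda> \<Longrightarrow> \<Lambda>; insert \<phi> \<Gamma> \<turnstile> \<psi> \<Longrightarrow> \<Lambda>; \<Gamma> \<turnstile> Imp \<phi> \<psi>"
| ImpE: "\<Lambda>; \<Gamma> \<turnstile> Imp \<phi> \<psi> \<Longrightarrow> \<Lambda>; \<Gamma> \<turnstile> \<phi> \<Longrightarrow> \<Lambda>; \<Gamma> \<turnstile> \<psi>"
| Contr: "\<phi> \<in> \<Lambda> \<Longrightarrow> \<Lambda>; insert (Neg \<phi>) \<Gamma> \<turnstile> Falsity \<Longrightarrow> \<Lambda>; \<Gamma> \<turnstile> \<phi>"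
| AllI: "\<Lambda>; lift ` \<Gamma> \<turnstile> \<phi> \<Longrightarrow> \<Lambda>; \<Gamma> \<turnstile> All \<phi>"
| AllE: "\<Lambda>; \<Gamma> \<turnstile> All \<phi> \<Longrightarrow> \<Lambda>; \<Gamma> \<turnstile> inst t \<phi>"
| EqI: "\<Lambda>; \<Gamma> \<turnstile> Eq t t"
| EqE: "\<phi> \<in> \<Lambda> \<Longrightarrow> \<Lambda>; \<Gamma> \<turnstile> Eq s t \<Longrightarrow> \<Lambda>; \<Gamma> \<turnstile> inst s \<phi> \<Longrightarrow> \<Lambda>; \<Gamma> \<turnstile> inst t \<phi>"

definition L_formulas :: "fm set" where
  "L_formulas = UNIV"

definition base_formulas :: "fm set" where
  "base_formulas = {\<phi>. sub_free \<phi>}"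

lemma sub_free_subst [simp]: "sub_free (subst \<sigma> \<phi>) = sub_free \<phi>"
  by (induction \<phi> arbitrary: \<sigma>) simp_all

lemma derives_base_sub_free: "base_formulas; \<Gamma> \<turnstile> \<phi> \<Longrightarrow> sub_free \<phi>"
  by (induction rule: derives.induct) (simp_all add: base_formulas_def inst_def)


section \<open>Structures\<close>

record 'a base_structure =
  carrier :: "'a set"
  emp :: 'a
  sing :: "'a \<Rightarrow> 'a"
  join :: "'a \<Rightarrow> 'a \<Rightarrow> 'a"

record 'a L_structure = "'a base_structure" +
  sub :: "('a \<times> 'a) set"

definition is_base_structure :: "('a, 'm) base_structure_scheme \<Rightarrow> bool" where
  "is_base_structure A \<longleftrightarrow>
     emp A \<in> carrier A \<and>
     (\<forall>x\<in>carrier A. sing A x \<in> carrier A) \<and>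
     (\<forall>x\<in>carrier A. \<forall>y\<in>carrier A. join A x y \<in> carrier A)"

definition is_L_structure :: "'a L_structure \<Rightarrow> bool" where
  "is_L_structure B \<longleftrightarrow> is_base_structure B \<and> sub B \<subseteq> carrier B \<times> carrier B"

definition expand :: "'a base_structure \<Rightarrow> ('a \<times> 'a) set \<Rightarrow> 'a L_structure" where
  "expand A R = base_structure.extend A (L_structure.fields R)"

definition is_expansion :: "'a L_structure \<Rightarrow> 'a base_structure \<Rightarrow> bool" where
  "is_expansion B A \<longleftrightarrow> is_L_structure B \<and> base_structure.truncate B = A"

primrec val :: "('a, 'm) base_structure_scheme \<Rightarrow> (nat \<Rightarrow> 'a) \<Rightarrow> tm \<Rightarrow> 'a" where
  "val A v (Var n) = v n"
| "val A v Emp = emp A"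
| "val A v (Sing t) = sing A (val A v t)"
| "val A v (Join s t) = join A (val A v s) (val A v t)"

primrec sat :: "'a L_structure \<Rightarrow> (nat \<Rightarrow> 'a) \<Rightarrow> fm \<Rightarrow> bool" where
  "sat B v Falsity = False"
| "sat B v (Eq s t) = (val B v s = val B v t)"
| "sat B v (Sub s t) = ((val B v s, val B v t) \<in> sub B)"
| "sat B v (Imp \<phi> \<psi>) = (sat B v \<phi> \<longrightarrow> sat B v \<psi>)"
| "sat B v (All \<phi>) = (\<forall>x\<in>carrier B. sat B (case_nat x v) \<phi>)"

definition L_model :: "'a L_structure \<Rightarrow> fm set \<Rightarrow> bool" where
  "L_model B T \<longleftrightarrow>
     is_L_structure B \<and> (\<forall>\<phi>\<in>T. \<forall>v. range v \<subseteq> carrier B \<longrightarrow> sat B v \<phi>)"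

text \<open>For a set \<open>T\<close> of \<open>\<sqsubseteq>\<close>-free formulas, truth in a structure without \<open>\<sqsubseteq>\<close>. The empty
  interpretation of \<open>\<sqsubseteq>\<close> is a dummy: see \<open>sat_sub_free_cong\<close> below.\<close>

definition base_model :: "'a base_structure \<Rightarrow> fm set \<Rightarrow> bool" where
  "base_model A T \<longleftrightarrow>
     is_base_structure A \<and> T \<subseteq> base_formulas \<and>
     (\<forall>\<phi>\<in>T. \<forall>v. range v \<subseteq> carrier A \<longrightarrow> sat (expand A {}) v \<phi>)"

lemma expand_simps [simp]:
  "carrier (expand A R) = carrier A" "emp (expand A R) = emp A"
  "sing (expand A R) = sing A" "join (expand A R) = join A" "sub (expand A R) = R"
  by (simp_all add: expand_def base_structure.defs L_structure.defs)

lemma truncate_expand: "base_structure.truncate (expand A R) = A"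
  by (simp add: base_structure.defs)

lemma val_expand [simp]: "val (expand A R) v t = val A v t"
  by (induction t) simp_all

lemma sat_sub_free_cong: "sub_free \<phi> \<Longrightarrow> sat (expand A R) v \<phi> = sat (expand A R') v \<phi>"
  by (induction \<phi> arbitrary: v) simp_all


section \<open>The axioms\<close>

text \<open>Universal closures; the quantifier prefix binds the variables in the order
  indicated, so that the last one is \<open>Var 0\<close> in the matrix.\<close>

text \<open>\<open>x, y, z\<close>\<close>
definition ax_F1 :: fm where
  "ax_F1 = All (All (All (Eq (Join (Join (Var 2) (Var 1)) (Var 0))
                             (Join (Var 2) (Join (Var 1) (Var 0))))))"

text \<open>\<open>x, y\<close>\<close>
definition ax_F2 :: fm where
  "ax_F2 = All (All (Eq (Join (Var 1) (Var 0)) (Join (Var 0) (Var 1))))"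

definition ax_F3 :: fm where
  "ax_F3 = All (Eq (Join (Var 0) Emp) (Var 0))"

text \<open>\<open>x, y, z\<close>\<close>
definition ax_F4 :: fm where
  "ax_F4 = All (All (All (Imp (Eq (Join (Var 2) (Var 0)) (Join (Var 1) (Var 0)))
                              (Eq (Var 2) (Var 1)))))"

definition ax_F5 :: fm where
  "ax_F5 = All (Neg (Eq (Sing (Var 0)) Emp))"

text \<open>\<open>x, y\<close>\<close>
definition ax_F6 :: fm where
  "ax_F6 = All (All (Imp (Eq (Join (Var 1) (Var 0)) Emp) (Eq (Var 1) Emp)))"

text \<open>\<open>x, y\<close>\<close>
definition ax_F7 :: fm where
  "ax_F7 = All (All (Imp (Eq (Sing (Var 1)) (Sing (Var 0))) (Eq (Var 1) (Var 0))))"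

text \<open>\<open>u, v, x, w\<close>, then existentially \<open>w'\<close>\<close>
definition ax_F8 :: fm where
  "ax_F8 = All (All (All (All
     (Imp (Eq (Join (Var 3) (Var 2)) (Join (Sing (Var 1)) (Var 0)))
          (Ex (Disj (Eq (Var 4) (Join (Sing (Var 2)) (Var 0)))
                    (Eq (Var 3) (Join (Sing (Var 2)) (Var 0)))))))))"

text \<open>\<open>x, t\<close>, then existentially \<open>w, u\<close>\<close>
definition ax_F9 :: fm where
  "ax_F9 = All (All
     (Iff (Sub (Var 1) (Var 0))
          (Disj (Eq (Var 1) (Var 0))
                (Ex (Ex (Conj (Eq (Var 2) (Join (Var 1) (Sing (Var 0))))
                              (Sub (Var 3) (Var 0))))))))"

definition F1_to_F8 :: "fm set" where
  "F1_to_F8 = {ax_F1, ax_F2, ax_F3, ax_F4, ax_F5, ax_F6, ax_F7, ax_F8}"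

definition Fminus :: "fm set" where
  "Fminus = insert ax_F9 F1_to_F8"

lemmas ax_defs = ax_F1_def ax_F2_def ax_F3_def ax_F4_def ax_F5_def ax_F6_def ax_F7_def
  ax_F8_def ax_F9_def

lemma sub_free_F1_to_F8: "F1_to_F8 \<subseteq> base_formulas"
  by (simp add: F1_to_F8_def base_formulas_def ax_defs)

lemma sentence_Fminus: "\<phi> \<in> Fminus \<Longrightarrow> sentence \<phi>"
  by (auto simp: Fminus_def F1_to_F8_def ax_defs sentence_def numeral_eq_Suc)

text \<open>The content of the axioms, with the de Bruijn indices resolved.\<close>

lemma sat_axioms:
  "sat B \<nu> ax_F1 \<longleftrightarrow> (\<forall>x\<in>carrier B. \<forall>y\<in>carrier B. \<forall>z\<in>carrier B.
     join B (join B x y) z = join B x (join B y z))"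
  "sat B \<nu> ax_F2 \<longleftrightarrow> (\<forall>x\<in>carrier B. \<forall>y\<in>carrier B. join B x y = join B y x)"
  "sat B \<nu> ax_F3 \<longleftrightarrow> (\<forall>x\<in>carrier B. join B x (emp B) = x)"
  "sat B \<nu> ax_F4 \<longleftrightarrow> (\<forall>x\<in>carrier B. \<forall>y\<in>carrier B. \<forall>z\<in>carrier B.
     join B x z = join B y z \<longrightarrow> x = y)"
  "sat B \<nu> ax_F5 \<longleftrightarrow> (\<forall>x\<in>carrier B. sing B x \<noteq> emp B)"
  "sat B \<nu> ax_F6 \<longleftrightarrow> (\<forall>x\<in>carrier B. \<forall>y\<in>carrier B. join B x y = emp B \<longrightarrow> x = emp B)"
  "sat B \<nu> ax_F7 \<longleftrightarrow> (\<forall>x\<in>carrier B. \<forall>y\<in>carrier B. sing B x = sing B y \<longrightarrow> x = y)"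
  "sat B \<nu> ax_F8 \<longleftrightarrow> (\<forall>u\<in>carrier B. \<forall>v\<in>carrier B. \<forall>x\<in>carrier B. \<forall>w\<in>carrier B.
     join B u v = join B (sing B x) w \<longrightarrow>
     (\<exists>w'\<in>carrier B. u = join B (sing B x) w' \<or> v = join B (sing B x) w'))"
  "sat B \<nu> ax_F9 \<longleftrightarrow> (\<forall>x\<in>carrier B. \<forall>t\<in>carrier B. (x, t) \<in> sub B \<longleftrightarrow>
     x = t \<or> (\<exists>w\<in>carrier B. \<exists>u\<in>carrier B. t = join B w (sing B u) \<and> (x, u) \<in> sub B))"
  by (simp_all add: ax_defs numeral_eq_Suc, blast+)

end

theory Submission
  imports Defs "HOL-Library.Countable"
begin

text \<open>Interpreting \<open>\<sqsubseteq>\<close> as the reflexive transitive closure of the relation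
  ``\<open>t = w \<uplus> \<langle>u\<rangle>\<close> for some \<open>w\<close>'' satisfies \<open>F\<^sub>9\<close> in every structure, which gives the expansion.
  Conservativity then follows semantically: by the completeness theorem, a \<open>\<sqsubseteq>\<close>-free formula that
  is not derivable fails in some model of the \<open>\<sqsubseteq>\<close>-free axioms, hence in the expansion of that
  model, against soundness. Completeness is proved by Henkin's method. Since the axioms form
  a finite set, each stage of the construction is a finite set of formulas, so some variable is
  not free in it and can serve as a witness; no new constants are needed.\<close>

section \<open>The expansion\<close>

definition constituent :: "'a base_structure \<Rightarrow> ('a \<times> 'a) set" where
  "constituent A = {(u, t). u \<in> carrier A \<and> t \<in> carrier A \<and>
     (\<exists>w\<in>carrier A. t = join A w (sing A u))}"

text \<open>The closure is reflexive on the whole type, so the intersection removes the pairs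
  \<open>(x, x)\<close> with \<open>x\<close> outside the carrier.\<close>

definition hereditary_constituent :: "'a base_structure \<Rightarrow> ('a \<times> 'a) set" where
  "hereditary_constituent A = (constituent A)\<^sup>* \<inter> carrier A \<times> carrier A"

text \<open>A chain of constituents is either trivial or has a last link. Links run inside the
  carrier, so the intermediate \<open>u\<close> lies there as well. This is the content of
  \<open>ax_F9\<close> for the new relation.\<close>

lemma hereditary_constituent_iff:
  assumes "x \<in> carrier A" "t \<in> carrier A"
  shows "(x, t) \<in> hereditary_constituent A \<longleftrightarrow>
    x = t \<or> (\<exists>w\<in>carrier A. \<exists>u\<in>carrier A.
      t = join A w (sing A u) \<and> (x, u) \<in> hereditary_constituent A)"
proof -
  have "(x, t) \<in> (constituent A)\<^sup>* \<longleftrightarrow>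
      x = t \<or> (\<exists>u. (x, u) \<in> (constituent A)\<^sup>* \<and> (u, t) \<in> constituent A)"
    by (metis rtrancl.cases rtrancl.rtrancl_into_rtrancl rtrancl.rtrancl_refl)
  with assms show ?thesis
    unfolding hereditary_constituent_def constituent_def by blast
qed

lemma expansion_model:
  assumes "base_model A F1_to_F8"
  shows "is_expansion (expand A (hereditary_constituent A)) A"
    and "L_model (expand A (hereditary_constituent A)) Fminus"
proof -
  let ?B = "expand A (hereditary_constituent A)"
  have str: "is_L_structure ?B"
    using assms by (auto simp: is_L_structure_def is_base_structure_def base_model_def
        hereditary_constituent_def)
  then show "is_expansion ?B A"
    by (simp add: is_expansion_def truncate_expand)
  have "sat ?B v \<phi>" if "\<phi> \<in> Fminus" "range v \<subseteq> carrier A" for v \<phi>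
  proof (cases "\<phi> = ax_F9")
    case True
    then show ?thesis
      using hereditary_constituent_iff[of _ A] by (simp add: sat_axioms)
  next
    case False
    with that have "\<phi> \<in> F1_to_F8"
      by (simp add: Fminus_def)
    with that assms show ?thesis
      using sat_sub_free_cong sub_free_F1_to_F8
      by (fastforce simp: base_model_def base_formulas_def)
  qed
  with str show "L_model ?B Fminus"
    by (simp add: L_model_def)
qed

section \<open>Substitution\<close>

lemma subst_tm_comp: "subst_tm \<tau> (subst_tm \<sigma> t) = subst_tm (\<lambda>n. subst_tm \<tau> (\<sigma> n)) t"
  by (induction t) simp_all

lemma subst_tm_Var [simp]: "subst_tm Var t = t"
  by (induction t) simp_all

lemma under_binder_simps [simp]:
  "under_binder \<sigma> 0 = Var 0"
  "under_binder \<sigma> (Suc n) = subst_tm (\<lambda>k. Var (Suc k)) (\<sigma> n)"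
  by (simp_all add: under_binder_def)

text \<open>Both sides fix index 0, and at a successor both give the shifted composed term. This
  carries \<open>subst_comp\<close> through a quantifier.\<close>

lemma under_binder_comp:
  "(\<lambda>n. subst_tm (under_binder \<tau>) (under_binder \<sigma> n)) = under_binder (\<lambda>n. subst_tm \<tau> (\<sigma> n))"
proof
  show "subst_tm (under_binder \<tau>) (under_binder \<sigma> n) = under_binder (\<lambda>n. subst_tm \<tau> (\<sigma> n)) n" for n
    by (cases n) (simp_all add: subst_tm_comp)
qed

lemma under_binder_Var [simp]: "under_binder Var = Var"
proof
  show "under_binder Var n = Var n" for n
    by (cases n) simp_all
qed

lemma subst_comp: "subst \<tau> (subst \<sigma> \<phi>) = subst (\<lambda>n. subst_tm \<tau> (\<sigma> n)) \<phi>"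
  by (induction \<phi> arbitrary: \<sigma> \<tau>) (simp_all add: subst_tm_comp under_binder_comp)

lemma subst_Var [simp]: "subst Var \<phi> = \<phi>"
  by (induction \<phi>) simp_all

lemma subst_tm_cong: "(\<And>n. n \<in> fv_tm t \<Longrightarrow> \<sigma> n = \<tau> n) \<Longrightarrow> subst_tm \<sigma> t = subst_tm \<tau> t"
  by (induction t) auto

text \<open>Turns freshness and closedness into equations: a renaming that differs from the shift
  only at a variable not free in a formula acts on it as \<open>lift\<close>, and every substitution
  fixes a sentence.\<close>

lemma subst_cong: "(\<And>n. n \<in> fv \<phi> \<Longrightarrow> \<sigma> n = \<tau> n) \<Longrightarrow> subst \<sigma> \<phi> = subst \<tau> \<phi>"
proof (induction \<phi> arbitrary: \<sigma> \<tau>)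
  case (All \<phi>)
  have "under_binder \<sigma> n = under_binder \<tau> n" if "n \<in> fv \<phi>" for n
    using that All.prems by (cases n) simp_all
  then show ?case
    using All.IH[of "under_binder \<sigma>" "under_binder \<tau>"] by simp
next
  case (Eq s t)
  then show ?case
    using subst_tm_cong[of s \<sigma> \<tau>] subst_tm_cong[of t \<sigma> \<tau>] by simp
next
  case (Sub s t)
  then show ?case
    using subst_tm_cong[of s \<sigma> \<tau>] subst_tm_cong[of t \<sigma> \<tau>] by simp
next
  case (Imp \<phi> \<psi>)
  show ?case
    using Imp.IH(1)[of \<sigma> \<tau>] Imp.IH(2)[of \<sigma> \<tau>] Imp.prems by simp
qed simp

lemma subst_lift: "subst (under_binder \<sigma>) (lift \<phi>) = lift (subst \<sigma> \<phi>)"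
  by (simp add: lift_def subst_comp)

lemma subst_inst: "subst \<sigma> (inst t \<phi>) = inst (subst_tm \<sigma> t) (subst (under_binder \<sigma>) \<phi>)"
proof -
  have "subst_tm \<sigma> (case_nat t Var n) =
      subst_tm (case_nat (subst_tm \<sigma> t) Var) (under_binder \<sigma> n)" for n
    by (cases n) (simp_all add: subst_tm_comp)
  then show ?thesis
    by (simp add: inst_def subst_comp)
qed

text \<open>The syntactic counterpart of the assignment \<open>case_nat x v\<close> in the clause of
  \<open>sat\<close> for \<open>All\<close>; the truth lemma \<open>sat_term_model\<close> matches
  the two.\<close>

lemma inst_subst_under_binder: "inst t (subst (under_binder \<sigma>) \<phi>) = subst (case_nat t \<sigma>) \<phi>"
proof -
  have "subst_tm (case_nat t Var) (under_binder \<sigma> n) = case_nat t \<sigma> n" for n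
    by (cases n) (simp_all add: subst_tm_comp)
  then show ?thesis
    by (simp add: inst_def subst_comp)
qed

lemma finite_fv_tm [simp]: "finite (fv_tm t)"
  by (induction t) simp_all

lemma finite_fv [simp]: "finite (fv \<phi>)"
proof (induction \<phi>)
  case (All \<phi>)
  then show ?case
    using finite_vimageI[of "fv \<phi>" Suc] by (simp add: vimage_def)
qed simp_all

section \<open>Soundness\<close>

lemma val_subst: "val B v (subst_tm \<sigma> t) = val B (\<lambda>n. val B v (\<sigma> n)) t"
  by (induction t) simp_all

lemma sat_subst: "sat B v (subst \<sigma> \<phi>) = sat B (\<lambda>n. val B v (\<sigma> n)) \<phi>"
proof (induction \<phi> arbitrary: v \<sigma>)
  case (All \<phi>)
  \<comment> \<open>The new value sits at index 0, and the shift in \<open>under_binder\<close>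
    makes every older term skip over it.\<close>
  have "(\<lambda>n. val B (case_nat x v) (under_binder \<sigma> n)) = case_nat x (\<lambda>n. val B v (\<sigma> n))" for x
  proof
    show "val B (case_nat x v) (under_binder \<sigma> n) = case_nat x (\<lambda>n. val B v (\<sigma> n)) n" for n
      by (cases n) (simp_all add: val_subst)
  qed
  then show ?case
    by (simp add: All.IH)
qed (simp_all add: val_subst)

lemma sat_lift: "sat B (case_nat x v) (lift \<phi>) = sat B v \<phi>"
  by (simp add: lift_def sat_subst)

lemma sat_inst: "sat B v (inst t \<phi>) = sat B (case_nat (val B v t) v) \<phi>"
proof -
  have "(\<lambda>n. val B v (case_nat t Var n)) = case_nat (val B v t) v"
    by (auto split: nat.split)
  then show ?thesis
    by (simp add: inst_def sat_subst)
qed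

lemma val_in_carrier:
  "is_base_structure B \<Longrightarrow> range v \<subseteq> carrier B \<Longrightarrow> val B v t \<in> carrier B"
  by (induction t) (auto simp: is_base_structure_def)

text \<open>The assignment varies in the induction because \<open>AllI\<close> passes to
  \<open>case_nat x v\<close>. It stays in the carrier so that the term used in \<open>AllE\<close>
  denotes an element over which the quantifier ranges.\<close>

lemma soundness:
  assumes "\<Lambda>; \<Gamma> \<turnstile> \<phi>" "is_L_structure B" "range v \<subseteq> carrier B" "\<And>\<psi>. \<psi> \<in> \<Gamma> \<Longrightarrow> sat B v \<psi>"
  shows "sat B v \<phi>"
  using assms
proof (induction arbitrary: v rule: derives.induct)
  case (ImpI \<phi> \<Gamma> \<psi>)
  then show ?case by (metis insert_iff sat.simps(4))
next
  case (Contr \<phi> \<Gamma>)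
  then show ?case by (metis insert_iff sat.simps(1,4))
next
  case (AllI \<Gamma> \<phi>)
  have "sat B (case_nat x v) \<phi>" if "x \<in> carrier B" for x
  proof (rule AllI.IH)
    show "range (case_nat x v) \<subseteq> carrier B"
      using that AllI.prems(2) by (fastforce split: nat.split)
  qed (use AllI.prems in \<open>auto simp: sat_lift\<close>)
  then show ?case by simp
next
  case (AllE \<Gamma> \<phi> t)
  have "val B v t \<in> carrier B"
    using AllE.prems by (simp add: val_in_carrier is_L_structure_def)
  moreover have "sat B v (All \<phi>)"
    using AllE by blast
  ultimately show ?case by (simp add: sat_inst)
next
  case (EqE \<phi> \<Gamma> s t)
  have "sat B v (Eq s t)" "sat B v (inst s \<phi>)"
    using EqE by blast+
  then show ?case by (simp add: sat_inst)
qed simp_all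

section \<open>Structural properties of derivations\<close>

lemma weakening: "\<Lambda>; \<Gamma> \<turnstile> \<phi> \<Longrightarrow> \<Gamma> \<subseteq> \<Gamma>' \<Longrightarrow> \<Lambda>; \<Gamma>' \<turnstile> \<phi>"
proof (induction arbitrary: \<Gamma>' rule: derives.induct)
  case (ImpI \<phi> \<Gamma> \<psi>)
  then show ?case by (meson derives.ImpI insert_mono)
next
  case (Contr \<phi> \<Gamma>)
  then show ?case by (meson derives.Contr insert_mono)
next
  case (AllI \<Gamma> \<phi>)
  then show ?case by (meson derives.AllI image_mono)
next
  case (ImpE \<Gamma> \<phi> \<psi>)
  show ?case by (rule derives.ImpE[OF ImpE.IH]) (rule ImpE.prems)+
next
  case (EqE \<phi> \<Gamma> s t)
  show ?case by (rule derives.EqE[OF EqE.hyps(1) EqE.IH]) (rule EqE.prems)+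
qed (auto intro: derives.Assm derives.AllE derives.EqI)

text \<open>Lets an inconsistency of the union of all stages be traced back to a single
  stage.\<close>

lemma finite_support: "\<Lambda>; \<Gamma> \<turnstile> \<phi> \<Longrightarrow> \<exists>\<Delta>\<subseteq>\<Gamma>. finite \<Delta> \<and> (\<Lambda>; \<Delta> \<turnstile> \<phi>)"
proof (induction rule: derives.induct)
  case (Assm \<phi> \<Gamma>)
  then show ?case
    by (intro exI[of _ "{\<phi>}"]) (auto intro: derives.Assm)
next
  case (ImpI \<phi> \<Gamma> \<psi>)
  then obtain \<Delta> where \<Delta>: "\<Delta> \<subseteq> insert \<phi> \<Gamma>" "finite \<Delta>" "\<Lambda>; \<Delta> \<turnstile> \<psi>"
    by blast
  \<comment> \<open>The discharged assumption is taken out of the support, which then lies in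
    \<Gamma>, and is put back explicitly for the rule.\<close>
  have "\<Lambda>; insert \<phi> (\<Delta> - {\<phi>}) \<turnstile> \<psi>"
    by (rule weakening[OF \<Delta>(3)]) blast
  with \<Delta> ImpI.hyps show ?case
    by (intro exI[of _ "\<Delta> - {\<phi>}"]) (auto intro: derives.ImpI)
next
  case (Contr \<phi> \<Gamma>)
  then obtain \<Delta> where \<Delta>: "\<Delta> \<subseteq> insert (Neg \<phi>) \<Gamma>" "finite \<Delta>" "\<Lambda>; \<Delta> \<turnstile> Falsity"
    by blast
  have "\<Lambda>; insert (Neg \<phi>) (\<Delta> - {Neg \<phi>}) \<turnstile> Falsity"
    by (rule weakening[OF \<Delta>(3)]) blast
  with \<Delta> Contr.hyps show ?case
    by (intro exI[of _ "\<Delta> - {Neg \<phi>}"]) (auto intro: derives.Contr)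
next
  case (ImpE \<Gamma> \<phi> \<psi>)
  then obtain \<Delta>\<^sub>1 \<Delta>\<^sub>2 where "\<Delta>\<^sub>1 \<subseteq> \<Gamma>" "finite \<Delta>\<^sub>1" "\<Lambda>; \<Delta>\<^sub>1 \<turnstile> Imp \<phi> \<psi>"
      "\<Delta>\<^sub>2 \<subseteq> \<Gamma>" "finite \<Delta>\<^sub>2" "\<Lambda>; \<Delta>\<^sub>2 \<turnstile> \<phi>"
    by blast
  then show ?case
    using derives.ImpE[OF weakening weakening, of \<Lambda> \<Delta>\<^sub>1 \<phi> \<psi> "\<Delta>\<^sub>1 \<union> \<Delta>\<^sub>2" \<Delta>\<^sub>2]
    by (intro exI[of _ "\<Delta>\<^sub>1 \<union> \<Delta>\<^sub>2"]) simp
next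
  case (AllI \<Gamma> \<phi>)
  then obtain \<Delta> where "\<Delta> \<subseteq> lift ` \<Gamma>" "finite \<Delta>" "\<Lambda>; \<Delta> \<turnstile> \<phi>"
    by blast
  \<comment> \<open>A finite set of lifted assumptions is the image of finitely many original
    ones.\<close>
  moreover from this obtain \<Delta>' where "\<Delta>' \<subseteq> \<Gamma>" "finite \<Delta>'" "\<Delta> = lift ` \<Delta>'"
    using finite_subset_image[of \<Delta> lift \<Gamma>] by blast
  ultimately show ?case
    using derives.AllI[of \<Lambda> \<Delta>' \<phi>] by blast
next
  case (AllE \<Gamma> \<phi> t)
  then show ?case by (blast intro: derives.AllE)
next
  case (EqI \<Gamma> t)
  then show ?case by (blast intro: derives.EqI)
next
  case (EqE \<phi> \<Gamma> s t)
  then obtain \<Delta>\<^sub>1 \<Delta>\<^sub>2 where "\<Delta>\<^sub>1 \<subseteq> \<Gamma>" "finite \<Delta>\<^sub>1" "\<Lambda>; \<Delta>\<^sub>1 \<turnstile> Eq s t"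
      "\<Delta>\<^sub>2 \<subseteq> \<Gamma>" "finite \<Delta>\<^sub>2" "\<Lambda>; \<Delta>\<^sub>2 \<turnstile> inst s \<phi>"
    by blast
  then show ?case
    using derives.EqE[OF EqE.hyps(1) weakening weakening, of \<Delta>\<^sub>1 s t "\<Delta>\<^sub>1 \<union> \<Delta>\<^sub>2" \<Delta>\<^sub>2]
    by (intro exI[of _ "\<Delta>\<^sub>1 \<union> \<Delta>\<^sub>2"]) simp
qed

section \<open>Substitution and generalization in derivations without
  \<open>\<sqsubseteq>\<close>\<close>

lemma base_formulas_simps [simp]:
  "Falsity \<in> base_formulas" "Eq s t \<in> base_formulas"
  "Imp \<phi> \<psi> \<in> base_formulas \<longleftrightarrow> \<phi> \<in> base_formulas \<and> \<psi> \<in> base_formulas"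
  "All \<phi> \<in> base_formulas \<longleftrightarrow> \<phi> \<in> base_formulas"
  "subst \<sigma> \<phi> \<in> base_formulas \<longleftrightarrow> \<phi> \<in> base_formulas"
  "inst t \<phi> \<in> base_formulas \<longleftrightarrow> \<phi> \<in> base_formulas"
  by (simp_all add: base_formulas_def inst_def)

text \<open>The side conditions of the rules survive because \<open>base_formulas\<close> is closed
  under substitution. The case \<open>AllI\<close> applies the induction hypothesis to
  \<open>under_binder \<sigma>\<close>, which commutes with lifting.\<close>

lemma derives_subst:
  "base_formulas; \<Gamma> \<turnstile> \<phi> \<Longrightarrow> base_formulas; subst \<sigma> ` \<Gamma> \<turnstile> subst \<sigma> \<phi>"
proof (induction arbitrary: \<sigma> rule: derives.induct)
  case (Assm \<phi> \<Gamma>)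
  then show ?case by (simp add: derives.Assm)
next
  case (ImpI \<phi> \<Gamma> \<psi>)
  then show ?case by (simp add: derives.ImpI)
next
  case (ImpE \<Gamma> \<phi> \<psi>)
  then show ?case by (metis derives.ImpE subst.simps(4))
next
  case (Contr \<phi> \<Gamma>)
  then show ?case by (simp add: derives.Contr)
next
  case (AllI \<Gamma> \<phi>)
  have "subst (under_binder \<sigma>) ` lift ` \<Gamma> = lift ` subst \<sigma> ` \<Gamma>"
    by (simp add: image_image subst_lift)
  with AllI.IH[of "under_binder \<sigma>"] show ?case
    by (simp add: derives.AllI)
next
  case (AllE \<Gamma> \<phi> t)
  then show ?case by (simp add: derives.AllE subst_inst)
next
  case (EqI \<Gamma> t)
  then show ?case by (simp add: derives.EqI)
next
  case (EqE \<phi> \<Gamma> s t)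
  then have "base_formulas; subst \<sigma> ` \<Gamma> \<turnstile> inst (subst_tm \<sigma> t) (subst (under_binder \<sigma>) \<phi>)"
    using derives.EqE[of "subst (under_binder \<sigma>) \<phi>" base_formulas "subst \<sigma> ` \<Gamma>"
        "subst_tm \<sigma> s" "subst_tm \<sigma> t"]
    by (simp add: subst_inst)
  then show ?case by (simp add: subst_inst)
qed

text \<open>The renaming that sends \<open>y\<close> to 0 and shifts all other variables turns the premise into
  that of \<open>AllI\<close>.\<close>

lemma generalization:
  assumes "base_formulas; \<Gamma> \<turnstile> inst (Var y) \<phi>" "\<And>\<psi>. \<psi> \<in> \<Gamma> \<Longrightarrow> y \<notin> fv \<psi>" "y \<notin> fv (All \<phi>)"
  shows "base_formulas; \<Gamma> \<turnstile> All \<phi>"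
proof (rule derives.AllI)
  let ?\<sigma> = "\<lambda>n. if n = y then Var 0 else Var (Suc n)"
  have "subst ?\<sigma> \<psi> = lift \<psi>" if "\<psi> \<in> \<Gamma>" for \<psi>
    unfolding lift_def using assms(2)[OF that] by (intro subst_cong) auto
  then have ctx: "subst ?\<sigma> ` \<Gamma> = lift ` \<Gamma>"
    by simp
  \<comment> \<open>Index 0 goes to \<open>y\<close> and back to 0; an index \<open>Suc m\<close>
    goes to \<open>m\<close> and back unless \<open>m = y\<close>, and \<open>Suc y\<close> is not
    free in \<phi>.\<close>
  have "subst (\<lambda>n. subst_tm ?\<sigma> (case_nat (Var y) Var n)) \<phi> = subst Var \<phi>"
    using assms(3) by (intro subst_cong) (auto split: nat.split)
  then have "subst ?\<sigma> (inst (Var y) \<phi>) = \<phi>"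
    by (simp add: inst_def subst_comp)
  then show "base_formulas; lift ` \<Gamma> \<turnstile> \<phi>"
    using derives_subst[OF assms(1), of ?\<sigma>] ctx by simp
qed

lemma derives_Falsity:
  assumes "base_formulas; \<Gamma> \<turnstile> Falsity" "\<phi> \<in> base_formulas"
  shows "base_formulas; \<Gamma> \<turnstile> \<phi>"
  by (rule derives.Contr[OF assms(2)]) (rule weakening[OF assms(1)], blast)

lemma derives_contradiction:
  assumes "\<phi> \<in> \<Gamma>" "Neg \<phi> \<in> \<Gamma>" "\<phi> \<in> base_formulas"
  shows "base_formulas; \<Gamma> \<turnstile> Falsity"
  by (rule derives.ImpE[of _ _ \<phi>]) (simp_all add: assms derives.Assm)

lemma derives_cut:
  assumes "\<Lambda>; insert \<phi> \<Gamma> \<turnstile> \<psi>" "\<Lambda>; \<Gamma> \<turnstile> \<phi>" "\<phi> \<in> \<Lambda>"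
  shows "\<Lambda>; \<Gamma> \<turnstile> \<psi>"
  by (rule derives.ImpE[OF derives.ImpI[OF assms(3,1)] assms(2)])

section \<open>Henkin sets and their term models\<close>

text \<open>Maximal consistent sets relative to the \<open>\<sqsubseteq>\<close>-free formulas, with
  witnesses taken among the terms already in the language.\<close>

locale henkin =
  fixes M :: "fm set"
  assumes consistent: "\<not> (base_formulas; M \<turnstile> Falsity)"
    and complete: "\<phi> \<in> base_formulas \<Longrightarrow> \<phi> \<in> M \<or> Neg \<phi> \<in> M"
    and witness: "Neg (All \<phi>) \<in> M \<Longrightarrow> \<phi> \<in> base_formulas \<Longrightarrow> \<exists>t. Neg (inst t \<phi>) \<in> M"
begin

lemma mem_iff_derives:
  assumes "\<phi> \<in> base_formulas"
  shows "\<phi> \<in> M \<longleftrightarrow> (base_formulas; M \<turnstile> \<phi>)"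
proof
  assume "base_formulas; M \<turnstile> \<phi>"
  then have "Neg \<phi> \<notin> M"
    using assms consistent derives.Assm derives.ImpE base_formulas_simps(1,3) by metis
  then show "\<phi> \<in> M"
    using complete[OF assms] by blast
qed (simp add: assms derives.Assm)

lemma Falsity_notin: "Falsity \<notin> M"
  using consistent mem_iff_derives by simp

lemma Imp_iff:
  assumes "\<phi> \<in> base_formulas" "\<psi> \<in> base_formulas"
  shows "Imp \<phi> \<psi> \<in> M \<longleftrightarrow> (\<phi> \<in> M \<longrightarrow> \<psi> \<in> M)"
proof
  assume "Imp \<phi> \<psi> \<in> M"
  then show "\<phi> \<in> M \<longrightarrow> \<psi> \<in> M"
    using assms by (metis mem_iff_derives base_formulas_simps(3) derives.ImpE)
next
  assume *: "\<phi> \<in> M \<longrightarrow> \<psi> \<in> M"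
  have "base_formulas; insert \<phi> M \<turnstile> \<psi>"
  proof (cases "\<phi> \<in> M")
    case True
    with * assms show ?thesis by (simp add: derives.Assm)
  next
    case False
    then have "Neg \<phi> \<in> M"
      using complete assms by blast
    then have "base_formulas; insert \<phi> M \<turnstile> Falsity"
      using assms by (intro derives_contradiction[of \<phi>]) simp_all
    then show ?thesis
      using assms by (simp add: derives_Falsity)
  qed
  then show "Imp \<phi> \<psi> \<in> M"
    using assms by (simp add: mem_iff_derives derives.ImpI)
qed

text \<open>If the universal formula were missing, its negation would be present by completeness,
  and the witness would negate one of the instances.\<close>

lemma All_iff:
  assumes "\<phi> \<in> base_formulas"
  shows "All \<phi> \<in> M \<longleftrightarrow> (\<forall>t. inst t \<phi> \<in> M)"
proof
  assume "All \<phi> \<in> M"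
  then show "\<forall>t. inst t \<phi> \<in> M"
    using assms by (simp add: mem_iff_derives derives.AllE)
next
  assume *: "\<forall>t. inst t \<phi> \<in> M"
  show "All \<phi> \<in> M"
  proof (rule ccontr)
    assume "All \<phi> \<notin> M"
    then obtain t where "Neg (inst t \<phi>) \<in> M"
      using complete[of "All \<phi>"] witness[of \<phi>] assms by auto
    with * assms show False
      using Imp_iff[of "inst t \<phi>" Falsity] Falsity_notin by simp
  qed
qed

section \<open>Equality in a Henkin set as a congruence on terms\<close>

lemma Eq_refl: "Eq t t \<in> M"
  by (simp add: mem_iff_derives derives.EqI)

lemma Eq_replace:
  assumes "Eq s t \<in> M" "inst s \<phi> \<in> M" "\<phi> \<in> base_formulas"
  shows "inst t \<phi> \<in> M"
  using assms derives.EqE[of \<phi> base_formulas M s t] by (simp add: mem_iff_derives)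

text \<open>Terms that are to stay fixed under replacement are shifted by one, so that instantiating
  the hole at index 0 restores them.\<close>

lemma inst_Eq_lift:
  "inst t (Eq (subst_tm (\<lambda>k. Var (Suc k)) r) u) = Eq r (subst_tm (case_nat t Var) u)"
  by (simp add: inst_def subst_tm_comp)

text \<open>Replacement in the left-hand side of \<open>Eq s s\<close>, with the right-hand side
  protected by the shift.\<close>

lemma Eq_sym: "Eq s t \<in> M \<Longrightarrow> Eq t s \<in> M"
  using Eq_replace[of s t "Eq (Var 0) (subst_tm (\<lambda>k. Var (Suc k)) s)"] Eq_refl[of s]
  by (simp add: inst_def subst_tm_comp)

lemma Eq_trans: "Eq r s \<in> M \<Longrightarrow> Eq s t \<in> M \<Longrightarrow> Eq r t \<in> M"
  using Eq_replace[of s t "Eq (subst_tm (\<lambda>k. Var (Suc k)) r) (Var 0)"]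
  by (simp add: inst_Eq_lift)

lemma Eq_Sing: "Eq s t \<in> M \<Longrightarrow> Eq (Sing s) (Sing t) \<in> M"
  using Eq_replace[of s t "Eq (subst_tm (\<lambda>k. Var (Suc k)) (Sing s)) (Sing (Var 0))"]
    Eq_refl[of "Sing s"]
  by (simp only: inst_Eq_lift) simp

text \<open>The arguments are replaced one at a time, and the two equations are chained by
  transitivity.\<close>

lemma Eq_Join:
  assumes "Eq s s' \<in> M" "Eq t t' \<in> M"
  shows "Eq (Join s t) (Join s' t') \<in> M"
proof -
  let ?sh = "subst_tm (\<lambda>k. Var (Suc k))"
  have "Eq (Join s t) (Join s' t) \<in> M"
    using Eq_replace[OF assms(1), of "Eq (?sh (Join s t)) (Join (Var 0) (?sh t))"]
      Eq_refl[of "Join s t"]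
    by (simp only: inst_Eq_lift) (simp add: subst_tm_comp)
  moreover have "Eq (Join s' t) (Join s' t') \<in> M"
    using Eq_replace[OF assms(2), of "Eq (?sh (Join s' t)) (Join (?sh s') (Var 0))"]
      Eq_refl[of "Join s' t"]
    by (simp only: inst_Eq_lift) (simp add: subst_tm_comp)
  ultimately show ?thesis by (rule Eq_trans)
qed

section \<open>The term model and its truth lemma\<close>

definition rep :: "tm \<Rightarrow> tm" where
  "rep t = (SOME s. Eq t s \<in> M)"

lemma Eq_rep: "Eq t (rep t) \<in> M"
  unfolding rep_def by (rule someI) (rule Eq_refl)

lemma rep_eq_iff: "rep s = rep t \<longleftrightarrow> Eq s t \<in> M"
proof
  show "rep s = rep t \<Longrightarrow> Eq s t \<in> M"
    by (metis Eq_rep Eq_sym Eq_trans)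
next
  assume "Eq s t \<in> M"
  \<comment> \<open>Both choices are thus made from the same predicate, so they coincide.\<close>
  then have "Eq s r \<in> M \<longleftrightarrow> Eq t r \<in> M" for r
    by (meson Eq_sym Eq_trans)
  then show "rep s = rep t"
    by (simp add: rep_def)
qed

text \<open>Chosen representatives stand in for equivalence classes, which keeps the carrier inside
  the type \<open>tm\<close>.\<close>

definition term_model :: "tm base_structure" where
  "term_model = \<lparr>carrier = range rep, emp = rep Emp, sing = (\<lambda>s. rep (Sing s)),
     join = (\<lambda>s t. rep (Join s t))\<rparr>"

lemma is_base_structure_term_model: "is_base_structure term_model"
  by (simp add: is_base_structure_def term_model_def)

lemma val_term_model: "val term_model (\<lambda>n. rep (\<sigma> n)) t = rep (subst_tm \<sigma> t)"
proof (induction t)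
  case (Sing t)
  then show ?case
    by (simp add: term_model_def rep_eq_iff) (blast intro: Eq_Sing Eq_sym Eq_rep)
next
  case (Join s t)
  then show ?case
    by (simp add: term_model_def rep_eq_iff) (blast intro: Eq_Join Eq_sym Eq_rep)
qed (simp_all add: term_model_def)

text \<open>Induction on \<phi> for all \<sigma> at once: a quantifier over the carrier ranges over
  the elements \<open>rep t\<close>, hence over all terms \<open>t\<close>, and extends \<sigma> by
  \<open>t\<close>.\<close>

lemma sat_term_model:
  "\<phi> \<in> base_formulas \<Longrightarrow>
    sat (expand term_model R) (\<lambda>n. rep (\<sigma> n)) \<phi> \<longleftrightarrow> subst \<sigma> \<phi> \<in> M"
proof (induction \<phi> arbitrary: \<sigma>)
  case Falsity
  show ?case by (simp add: Falsity_notin)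
next
  case (Eq s t)
  show ?case by (simp add: val_term_model rep_eq_iff)
next
  case (Sub s t)
  then show ?case by (simp add: base_formulas_def)
next
  case (Imp \<phi> \<psi>)
  then show ?case by (simp add: Imp_iff)
next
  case (All \<phi>)
  have "case_nat (rep t) (\<lambda>n. rep (\<sigma> n)) = (\<lambda>n. rep (case_nat t \<sigma> n))" for t
    by (auto split: nat.split)
  then have "sat (expand term_model R) (\<lambda>n. rep (\<sigma> n)) (All \<phi>) \<longleftrightarrow>
      (\<forall>t. subst (case_nat t \<sigma>) \<phi> \<in> M)"
    using All by (simp add: term_model_def)
  also have "\<dots> \<longleftrightarrow> subst \<sigma> (All \<phi>) \<in> M"
    using All.prems by (simp add: All_iff inst_subst_under_binder)
  finally show ?case .
qed

end

section \<open>Completeness\<close>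

instance tm :: countable by countable_datatype
instance fm :: countable by countable_datatype

section \<open>The stages of the Henkin construction\<close>

definition fresh_var :: "fm set \<Rightarrow> nat" where
  "fresh_var \<Gamma> = (SOME y. \<forall>\<psi>\<in>\<Gamma>. y \<notin> fv \<psi>)"

lemma fresh_var:
  assumes "finite \<Gamma>" "\<psi> \<in> \<Gamma>"
  shows "fresh_var \<Gamma> \<notin> fv \<psi>"
proof -
  have "finite (\<Union>(fv ` \<Gamma>))"
    using assms by simp
  then obtain y where "y \<notin> \<Union>(fv ` \<Gamma>)"
    using ex_new_if_finite infinite_UNIV_nat by blast
  then have "\<exists>y. \<forall>\<psi>\<in>\<Gamma>. y \<notin> fv \<psi>"
    by blast
  from someI_ex[OF this] show ?thesis
    using assms(2) by (simp add: fresh_var_def)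
qed

fun counterexample :: "nat \<Rightarrow> fm \<Rightarrow> fm set" where
  "counterexample y (All \<phi>) = {Neg (inst (Var y) \<phi>)}"
| "counterexample y \<phi> = {}"

text \<open>A rejected universal formula receives its counterexample in the same step, at a variable
  fresh also for its negation. Formulas containing \<open>\<sqsubseteq>\<close> are skipped, since
  the enumeration runs through all of \<open>fm\<close>.\<close>

definition decide :: "fm \<Rightarrow> fm set \<Rightarrow> fm set" where
  "decide \<phi> \<Gamma> =
     (if \<phi> \<notin> base_formulas then \<Gamma>
      else if base_formulas; insert \<phi> \<Gamma> \<turnstile> Falsity
      then insert (Neg \<phi>) \<Gamma> \<union> counterexample (fresh_var (insert (Neg \<phi>) \<Gamma>)) \<phi>
      else insert \<phi> \<Gamma>)"

primrec stage :: "fm set \<Rightarrow> nat \<Rightarrow> fm set" where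
  "stage \<Gamma> 0 = \<Gamma>"
| "stage \<Gamma> (Suc n) = decide (from_nat n) (stage \<Gamma> n)"

lemma finite_decide: "finite \<Gamma> \<Longrightarrow> finite (decide \<phi> \<Gamma>)"
  by (cases \<phi>) (simp_all add: decide_def)

text \<open>If \<phi> cannot be added, then \<Gamma> derives its negation, and a cut shows that
  adding the negation is safe. Were the counterexample refutable, the instance at the fresh variable
  would be derivable, and generalizing would yield the rejected \<phi>.\<close>

lemma decide_consistent:
  assumes "finite \<Gamma>" "\<not> (base_formulas; \<Gamma> \<turnstile> Falsity)"
  shows "\<not> (base_formulas; decide \<phi> \<Gamma> \<turnstile> Falsity)"
proof (cases "\<phi> \<in> base_formulas \<and> (base_formulas; insert \<phi> \<Gamma> \<turnstile> Falsity)")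
  case False
  with assms show ?thesis by (auto simp: decide_def)
next
  case True
  let ?\<Delta> = "insert (Neg \<phi>) \<Gamma>"
  have "base_formulas; \<Gamma> \<turnstile> Neg \<phi>"
    using True by (simp add: derives.ImpI)
  then have con: "\<not> (base_formulas; ?\<Delta> \<turnstile> Falsity)"
    using derives_cut[of base_formulas "Neg \<phi>" \<Gamma> Falsity] assms(2) True by auto
  show ?thesis
  proof (cases "\<exists>\<psi>. \<phi> = All \<psi>")
    case False
    then have "counterexample y \<phi> = {}" for y
      by (cases \<phi>) simp_all
    with con True show ?thesis by (simp add: decide_def)
  next
    case all: True
    then obtain \<psi> where \<psi>: "\<phi> = All \<psi>" by blast
    let ?y = "fresh_var ?\<Delta>"
    have "\<not> (base_formulas; insert (Neg (inst (Var ?y) \<psi>)) ?\<Delta> \<turnstile> Falsity)"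
    proof
      assume "base_formulas; insert (Neg (inst (Var ?y) \<psi>)) ?\<Delta> \<turnstile> Falsity"
      then have "base_formulas; ?\<Delta> \<turnstile> inst (Var ?y) \<psi>"
        using True \<psi> derives.Contr by simp
      moreover have fresh: "?y \<notin> fv \<chi>" if "\<chi> \<in> ?\<Delta>" for \<chi>
        using that assms(1) by (intro fresh_var) simp_all
      \<comment> \<open>This is why freshness was demanded for the set that includes the negation of
        \<phi>.\<close>
      moreover have "?y \<notin> fv (All \<psi>)"
        using fresh[of "Neg \<phi>"] \<psi> by simp
      ultimately have "base_formulas; ?\<Delta> \<turnstile> \<phi>"
        unfolding \<psi> by (rule generalization)
      moreover have "base_formulas; ?\<Delta> \<turnstile> Neg \<phi>"
        using True by (simp add: derives.Assm)
      ultimately show False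
        using con derives.ImpE by blast
    qed
    with True \<psi> show ?thesis by (simp add: decide_def insert_commute)
  qed
qed

lemma stage_finite: "finite \<Gamma> \<Longrightarrow> finite (stage \<Gamma> n)"
  by (induction n) (simp_all add: finite_decide)

lemma stage_consistent:
  assumes "finite \<Gamma>" "\<not> (base_formulas; \<Gamma> \<turnstile> Falsity)"
  shows "\<not> (base_formulas; stage \<Gamma> n \<turnstile> Falsity)"
  using assms by (induction n) (simp_all add: decide_consistent stage_finite)

lemma decide_complete: "\<phi> \<in> base_formulas \<Longrightarrow> \<phi> \<in> decide \<phi> \<Gamma> \<or> Neg \<phi> \<in> decide \<phi> \<Gamma>"
  by (simp add: decide_def)

lemma decide_witness:
  "\<phi> \<in> base_formulas \<Longrightarrow>
    All \<phi> \<in> decide (All \<phi>) \<Gamma> \<or> (\<exists>t. Neg (inst t \<phi>) \<in> decide (All \<phi>) \<Gamma>)"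
  by (auto simp: decide_def)

lemma decide_mono: "\<Gamma> \<subseteq> decide \<phi> \<Gamma>"
  by (auto simp: decide_def)

lemma stage_mono:
  assumes "m \<le> n"
  shows "stage \<Gamma> m \<subseteq> stage \<Gamma> n"
  using lift_Suc_mono_le[of "stage \<Gamma>", OF _ assms] by (simp add: decide_mono)

lemma finite_subset_stage:
  assumes "finite \<Delta>" "\<Delta> \<subseteq> (\<Union>n. stage \<Gamma> n)"
  shows "\<exists>n. \<Delta> \<subseteq> stage \<Gamma> n"
  using assms
proof (induction \<Delta> rule: finite_induct)
  case (insert \<phi> \<Delta>)
  then obtain m n where "\<phi> \<in> stage \<Gamma> m" "\<Delta> \<subseteq> stage \<Gamma> n"
    by auto
  then have "insert \<phi> \<Delta> \<subseteq> stage \<Gamma> (max m n)"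
    using stage_mono[of m "max m n" \<Gamma>] stage_mono[of n "max m n" \<Gamma>] by auto
  then show ?case by blast
qed simp

lemma henkin_extension:
  assumes "finite \<Gamma>" "\<not> (base_formulas; \<Gamma> \<turnstile> Falsity)"
  shows "henkin (\<Union>n. stage \<Gamma> n)"
proof
  let ?M = "\<Union>n. stage \<Gamma> n"
  show con: "\<not> (base_formulas; ?M \<turnstile> Falsity)"
  proof
    assume "base_formulas; ?M \<turnstile> Falsity"
    then obtain \<Delta> where \<Delta>: "finite \<Delta>" "\<Delta> \<subseteq> ?M" "base_formulas; \<Delta> \<turnstile> Falsity"
      using finite_support[of base_formulas ?M Falsity] by blast
    then obtain n where "\<Delta> \<subseteq> stage \<Gamma> n"
      using finite_subset_stage[of \<Delta> \<Gamma>] by blast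
    from weakening[OF \<Delta>(3) this] stage_consistent[OF assms] show False
      by blast
  qed
  \<comment> \<open>Each formula is decided at the stage given by its own code.\<close>
  have step: "decide \<phi> (stage \<Gamma> (to_nat \<phi>)) \<subseteq> ?M" for \<phi>
  proof -
    have "decide \<phi> (stage \<Gamma> (to_nat \<phi>)) = stage \<Gamma> (Suc (to_nat \<phi>))"
      by simp
    then show ?thesis by blast
  qed
  show "\<phi> \<in> ?M \<or> Neg \<phi> \<in> ?M" if "\<phi> \<in> base_formulas" for \<phi>
    using decide_complete[OF that] step[of \<phi>] by blast
  show "\<exists>t. Neg (inst t \<phi>) \<in> ?M" if neg: "Neg (All \<phi>) \<in> ?M" and base: "\<phi> \<in> base_formulas" for \<phi>
  proof -
    \<comment> \<open>Its own decision step must then have rejected \<open>All \<phi>\<close>, and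
      so have supplied the witness.\<close>
    have "All \<phi> \<notin> ?M"
    proof
      assume "All \<phi> \<in> ?M"
      then have "base_formulas; ?M \<turnstile> Falsity"
        using neg base by (intro derives_contradiction[of "All \<phi>"]) simp_all
      with con show False ..
    qed
    then have "All \<phi> \<notin> decide (All \<phi>) (stage \<Gamma> (to_nat (All \<phi>)))"
      using step by (rule contra_subsetD[rotated])
    then obtain t where "Neg (inst t \<phi>) \<in> decide (All \<phi>) (stage \<Gamma> (to_nat (All \<phi>)))"
      using decide_witness[OF base] by blast
    then have "Neg (inst t \<phi>) \<in> ?M"
      using step by (rule subsetD[rotated])
    then show ?thesis ..
  qed
qed

text \<open>If \<phi> is not derivable, adding its negation to \<Gamma> is consistent and extends to
  a Henkin set. Sentences are fixed by substitution, so those of \<Gamma> hold in the term model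
  under every assignment, while \<phi> fails under one.\<close>

lemma completeness:
  assumes "finite \<Gamma>" "\<Gamma> \<subseteq> base_formulas" "\<phi> \<in> base_formulas"
    and "\<And>\<psi>. \<psi> \<in> \<Gamma> \<Longrightarrow> sentence \<psi>"
    and valid: "\<And>(A :: tm base_structure) v. base_model A \<Gamma> \<Longrightarrow> range v \<subseteq> carrier A \<Longrightarrow>
      sat (expand A {}) v \<phi>"
  shows "base_formulas; \<Gamma> \<turnstile> \<phi>"
proof (rule ccontr)
  assume nd: "\<not> (base_formulas; \<Gamma> \<turnstile> \<phi>)"
  define \<Delta> where "\<Delta> = insert (Neg \<phi>) \<Gamma>"
  define M where "M = (\<Union>n. stage \<Delta> n)"
  have "\<not> (base_formulas; \<Delta> \<turnstile> Falsity)"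
    unfolding \<Delta>_def using nd derives.Contr[OF assms(3)] by blast
  then interpret henkin M
    unfolding M_def using assms(1) by (intro henkin_extension) (simp_all add: \<Delta>_def)
  have \<Delta>: "\<Delta> \<subseteq> M"
    unfolding M_def using stage.simps(1)[of \<Delta>] by blast
  have "sat (expand term_model {}) v \<psi>" if "\<psi> \<in> \<Gamma>" "range v \<subseteq> carrier term_model" for v \<psi>
  proof -
    have "\<forall>n. \<exists>t. v n = rep t"
      using that(2) by (auto simp: term_model_def)
    then obtain \<sigma> where v: "v = (\<lambda>n. rep (\<sigma> n))"
      by metis
    have "subst \<sigma> \<psi> = subst Var \<psi>"
      using assms(4)[OF that(1)] by (intro subst_cong) (simp add: sentence_def)
    then have "subst \<sigma> \<psi> \<in> M"
      using that(1) \<Delta> by (auto simp: \<Delta>_def)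
    then show ?thesis
      using sat_term_model[of \<psi>] v that(1) assms(2) by auto
  qed
  then have "base_model term_model \<Gamma>"
    using assms(2) by (simp add: base_model_def is_base_structure_term_model)
  \<comment> \<open>The canonical assignment corresponds to the identity substitution, so truth of
    \<phi> there means membership in \<open>M\<close>.\<close>
  then have "sat (expand term_model {}) (\<lambda>n. rep (Var n)) \<phi>"
    by (intro valid) (auto simp: term_model_def)
  then have "\<phi> \<in> M"
    using sat_term_model[of \<phi> "{}" Var] assms(3) by simp
  moreover have "Neg \<phi> \<in> M"
    using \<Delta> by (simp add: \<Delta>_def)
  ultimately show False
    using Imp_iff[of \<phi> Falsity] Falsity_notin assms(3) by simp
qed

section \<open>Conservativity\<close>

theorem proposition7p3:
  "(\<forall>A :: 'a base_structure. base_model A F1_to_F8 \<longrightarrow>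
      (\<exists>B. is_expansion B A \<and> L_model B Fminus)) \<and>
   (\<forall>\<phi>. sentence \<phi> \<and> sub_free \<phi> \<and> (L_formulas; Fminus \<turnstile> \<phi>) \<longrightarrow>
      (base_formulas; F1_to_F8 \<turnstile> \<phi>))"
proof (intro conjI allI impI)
  fix A :: "'a base_structure"
  assume "base_model A F1_to_F8"
  then show "\<exists>B. is_expansion B A \<and> L_model B Fminus"
    using expansion_model by blast
next
  fix \<phi>
  assume *: "sentence \<phi> \<and> sub_free \<phi> \<and> (L_formulas; Fminus \<turnstile> \<phi>)"
  show "base_formulas; F1_to_F8 \<turnstile> \<phi>"
  \<comment> \<open>Only structures on \<open>tm\<close> have to be considered;
    \<open>expansion_model\<close> is applied at that type rather than at the type of the first
    conjunct.\<close>
  proof (rule completeness)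
    fix A :: "tm base_structure" and v :: "nat \<Rightarrow> tm"
    assume A: "base_model A F1_to_F8" and v: "range v \<subseteq> carrier A"
    let ?B = "expand A (hereditary_constituent A)"
    have "L_model ?B Fminus"
      using A by (rule expansion_model)
    \<comment> \<open>Soundness is applied in the expansion, and the result returns to
      \<open>A\<close> because \<phi> does not mention \<open>\<sqsubseteq>\<close>.\<close>
    then have "sat ?B v \<phi>"
      using * v soundness[of L_formulas Fminus \<phi> ?B v] by (simp add: L_model_def)
    then show "sat (expand A {}) v \<phi>"
      using * sat_sub_free_cong[of \<phi> A "hereditary_constituent A" v "{}"] by simp
  next
    show "finite F1_to_F8"
      by (simp add: F1_to_F8_def)
    show "F1_to_F8 \<subseteq> base_formulas"
      by (rule sub_free_F1_to_F8)
    show "\<phi> \<in> base_formulas"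
      using * by (simp add: base_formulas_def)
    show "sentence \<psi>" if "\<psi> \<in> F1_to_F8" for \<psi>
      using that by (intro sentence_Fminus) (simp add: Fminus_def)
  qed
qed

end
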